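(* Let $T=(V,E)$ be a tree with at least two vertices, with unit edge lengths $\ell\equiv 1$, unit interdiction costs $b\equiv 1$, interdiction budget $B=1$ and number of locations $p=B+1=2$. Let $X^*\subseteq V$ be the set of optimal solutions (vertices) of the $1$-median location problem on $T$, i.e. the vertices $x$ minimizing $\sum_{v\in V} d_T(v,x)$. Choose a leaf $v$ of $T$ that minimizes $\min_{r^*\in X^*} d_T(r^*,v)$ among all leaves of $T$. Then interdicting the (unique) edge incident to $v$ is an optimal interdiction strategy for the $p$-median location interdiction problem on $T$.
   Context: $p$-median location interdiction problem (optimization version): given an undirected graph $G=(V,E)$, edge lengths $\ell$, interdiction costs $b$, budget $B$ and integer $p$, an interdiction strategy is a vector $\gamma\in\{0,1\}^{E}$ with $\sum_{e} b(e)\gamma_e\le B$, inducing $G(\gamma)=(V,E\setminus\{e:\gamma_e=1\})$. Its value is $\min_{X\subseteq V,|X|=p}\sum_{v\in V} d_{G(\gamma)}(v,X)$, where $d_{G(\gamma)}(v,X)=\min_{x\in X} d_{G(\gamma)}(v,x)$ and $d_{G(\gamma)}$ is the shortest-path distance in $G(\gamma)$ w.r.t. $\ell$ (infinite if no path exists). A strategy is optimal if it maximizes this value over all interdiction strategies. *)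

theory Defs
  imports Complex_Main "HOL-Library.Extended_Real" "HOL-Library.FuncSet" "HOL-Library.Indicator_Function"
begin

definition simple_graph :: "'a set \<Rightarrow> 'a set set \<Rightarrow> bool" where
  "simple_graph V E \<longleftrightarrow> finite V \<and> E \<subseteq> {e. e \<subseteq> V \<and> card e = 2}"

fun walk_edges :: "'a list \<Rightarrow> 'a set list" where
  "walk_edges (x # y # xs) = {x, y} # walk_edges (y # xs)"
| "walk_edges _ = []"

definition paths_between :: "'a set \<Rightarrow> 'a set set \<Rightarrow> 'a \<Rightarrow> 'a \<Rightarrow> 'a list set" where
  "paths_between V E u w =
    {xs. xs \<noteq> [] \<and> hd xs = u \<and> last xs = w \<and> distinct xs \<and> set xs \<subseteq> V \<and> set (walk_edges xs) \<subseteq> E}"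

definition graph_connected :: "'a set \<Rightarrow> 'a set set \<Rightarrow> bool" where
  "graph_connected V E \<longleftrightarrow> V \<noteq> {} \<and> (\<forall>u\<in>V. \<forall>w\<in>V. paths_between V E u w \<noteq> {})"

definition is_cycle :: "'a set \<Rightarrow> 'a set set \<Rightarrow> 'a list \<Rightarrow> bool" where
  "is_cycle V E xs \<longleftrightarrow> length xs \<ge> 3 \<and> distinct xs \<and> set xs \<subseteq> V \<and>
    set (walk_edges xs) \<subseteq> E \<and> {last xs, hd xs} \<in> E"

definition is_tree :: "'a set \<Rightarrow> 'a set set \<Rightarrow> bool" where
  "is_tree V E \<longleftrightarrow> simple_graph V E \<and> graph_connected V E \<and> (\<nexists>xs. is_cycle V E xs)"

definition is_leaf :: "'a set \<Rightarrow> 'a set set \<Rightarrow> 'a \<Rightarrow> bool" where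
  "is_leaf V E v \<longleftrightarrow> v \<in> V \<and> card {e \<in> E. v \<in> e} = 1"

text \<open>The infimum over the empty set of paths is \<open>\<infinity>\<close>, so vertices in different components are at
  infinite distance.\<close>

definition graph_dist :: "'a set \<Rightarrow> 'a set set \<Rightarrow> ('a set \<Rightarrow> real) \<Rightarrow> 'a \<Rightarrow> 'a \<Rightarrow> ereal" where
  "graph_dist V E l u w =
    (INF xs\<in>paths_between V E u w. ereal (sum_list (map l (walk_edges xs))))"

definition dist_to_set :: "'a set \<Rightarrow> 'a set set \<Rightarrow> ('a set \<Rightarrow> real) \<Rightarrow> 'a \<Rightarrow> 'a set \<Rightarrow> ereal" where
  "dist_to_set V E l v X = (INF x\<in>X. graph_dist V E l v x)"

definition median_value :: "'a set \<Rightarrow> 'a set set \<Rightarrow> ('a set \<Rightarrow> real) \<Rightarrow> nat \<Rightarrow> ereal" where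
  "median_value V E l p = (INF X\<in>{X. X \<subseteq> V \<and> card X = p}. \<Sum>v\<in>V. dist_to_set V E l v X)"

definition one_medians :: "'a set \<Rightarrow> 'a set set \<Rightarrow> ('a set \<Rightarrow> real) \<Rightarrow> 'a set" where
  "one_medians V E l =
    {x \<in> V. \<forall>y\<in>V. (\<Sum>v\<in>V. graph_dist V E l v x) \<le> (\<Sum>v\<in>V. graph_dist V E l v y)}"

text \<open>A strategy is a 0/1-vector indexed by \<open>E\<close>; the values of \<open>\<gamma>\<close> outside \<open>E\<close> are irrelevant.\<close>

definition interdiction_strategies ::
    "'a set set \<Rightarrow> ('a set \<Rightarrow> real) \<Rightarrow> real \<Rightarrow> ('a set \<Rightarrow> real) set" where
  "interdiction_strategies E b B = {\<gamma>. \<gamma> \<in> E \<rightarrow> {0, 1} \<and> (\<Sum>e\<in>E. b e * \<gamma> e) \<le> B}"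

definition remaining_edges :: "'a set set \<Rightarrow> ('a set \<Rightarrow> real) \<Rightarrow> 'a set set" where
  "remaining_edges E \<gamma> = E - {e. \<gamma> e = 1}"

definition interdiction_value ::
    "'a set \<Rightarrow> 'a set set \<Rightarrow> ('a set \<Rightarrow> real) \<Rightarrow> nat \<Rightarrow> ('a set \<Rightarrow> real) \<Rightarrow> ereal" where
  "interdiction_value V E l p \<gamma> = median_value V (remaining_edges E \<gamma>) l p"

definition optimal_interdiction ::
    "'a set \<Rightarrow> 'a set set \<Rightarrow> ('a set \<Rightarrow> real) \<Rightarrow> ('a set \<Rightarrow> real) \<Rightarrow> real \<Rightarrow> nat \<Rightarrow> ('a set \<Rightarrow> real) \<Rightarrow> bool"
  where
  "optimal_interdiction V E l b B p \<gamma> \<longleftrightarrow>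
    \<gamma> \<in> interdiction_strategies E b B \<and>
    (\<forall>\<gamma>'\<in>interdiction_strategies E b B.
      interdiction_value V E l p \<gamma>' \<le> interdiction_value V E l p \<gamma>)"

end

theory Submission
  imports Defs
begin

text \<open>Write \<open>D x\<close> for the sum of the distances to \<open>x\<close>. It is strictly convex along the paths of the
  tree, so any two medians are adjacent, and every vertex \<open>x\<close> satisfies \<open>D x \<ge> D r + d(r, x)\<close> for some
  median \<open>r\<close>. Let \<open>m\<close> be the distance from the medians to \<open>v\<close>, and let \<open>c\<close> be \<open>1\<close> if there are two
  medians and \<open>0\<close> otherwise. Every median is within \<open>m + c\<close> of \<open>v\<close>, so cutting off \<open>v\<close>
  leaves a value of at least \<open>D r - (m + c)\<close>.

  Conversely, cut an edge \<open>{a, b}\<close> with \<open>b\<close> on the far side from a median \<open>r\<close>, and let \<open>k\<close> be the size of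
  the component of \<open>b\<close>. The locations \<open>r\<close> and \<open>b\<close> cost \<open>D r - k d(r, b)\<close>, and a vertex \<open>w\<close> of that
  component farthest from \<open>r\<close> is a leaf with \<open>d(r, w) \<le> d(r, b) + k - 1 \<le> k d(r, b)\<close>. As \<open>w\<close> is a leaf,
  all medians have distance at least \<open>m\<close> from it, and for a suitable choice of \<open>r\<close> and \<open>b\<close> even
  \<open>d(r, w) \<ge> m + c\<close>.\<close>

section \<open>Walks, simple paths, and uniqueness of paths without cycles\<close>

lemma walk_edges_append:
  "walk_edges (xs @ y # ys) = walk_edges (xs @ [y]) @ walk_edges (y # ys)"
  by (induction xs rule: walk_edges.induct) auto

lemma walk_edges_snoc: "xs \<noteq> [] \<Longrightarrow> walk_edges (xs @ [y]) = walk_edges xs @ [{last xs, y}]"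
  by (induction xs rule: walk_edges.induct) auto

lemma walk_edges_Cons: "xs \<noteq> [] \<Longrightarrow> walk_edges (x # xs) = {x, hd xs} # walk_edges xs"
  by (cases xs) auto

lemma walk_edges_rev: "walk_edges (rev xs) = rev (walk_edges xs)"
proof (induction xs rule: walk_edges.induct)
  case (1 x y xs)
  have "walk_edges (rev (x # y # xs)) = walk_edges (rev xs @ y # [x])"
    by simp
  also have "\<dots> = walk_edges (rev (y # xs)) @ [{y, x}]"
    by (subst walk_edges_append) simp
  finally show ?case using 1 by (simp add: insert_commute)
qed auto

lemma length_walk_edges: "length (walk_edges xs) = length xs - 1"
  by (induction xs rule: walk_edges.induct) auto

lemma walk_edges_subset: "f \<in> set (walk_edges xs) \<Longrightarrow> f \<subseteq> set xs"
  by (induction xs rule: walk_edges.induct) auto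

lemma paths_between_mono: "F \<subseteq> E \<Longrightarrow> paths_between V F u w \<subseteq> paths_between V E u w"
  by (auto simp: paths_between_def)

lemma paths_between_rev: "xs \<in> paths_between V E u w \<Longrightarrow> rev xs \<in> paths_between V E w u"
  by (auto simp: paths_between_def hd_rev last_rev walk_edges_rev)

lemma paths_between_split:
  assumes "p @ x # q \<in> paths_between V E u w"
  shows "p @ [x] \<in> paths_between V E u x" "x # q \<in> paths_between V E x w"
proof -
  have "hd (p @ [x]) = hd (p @ x # q)" by (cases p) auto
  then show "p @ [x] \<in> paths_between V E u x" "x # q \<in> paths_between V E x w"
    using assms walk_edges_append[of p x q] by (auto simp: paths_between_def)
qed

lemma paths_between_snoc:
  "xs \<in> paths_between V E u x \<Longrightarrow> {x, y} \<in> E \<Longrightarrow> y \<in> V \<Longrightarrow> y \<notin> set xs \<Longrightarrow>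
    xs @ [y] \<in> paths_between V E u y"
  by (auto simp: paths_between_def walk_edges_snoc)

lemma graph_dist_antimono: "F \<subseteq> E \<Longrightarrow> graph_dist V E l u w \<le> graph_dist V F l u w"
  unfolding graph_dist_def by (rule INF_superset_mono) (auto dest: paths_between_mono)

lemma median_value_antimono: "F \<subseteq> E \<Longrightarrow> median_value V E l p \<le> median_value V F l p"
  unfolding median_value_def dist_to_set_def
  by (intro INF_mono' sum_mono graph_dist_antimono)

text \<open>Induction strips the common first vertex. If two paths leave \<open>u\<close> towards
  different neighbours, following one of them up to its first vertex on the other and returning
  along the other closes a cycle through \<open>u\<close>.\<close>

lemma acyclic_paths_between_unique:
  assumes "\<nexists>c. is_cycle V E c"
  shows "xs \<in> paths_between V E u w \<Longrightarrow> ys \<in> paths_between V E u w \<Longrightarrow> xs = ys"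
proof (induction xs arbitrary: u ys)
  case Nil
  then show ?case by (simp add: paths_between_def)
next
  case (Cons a xs)
  from Cons.prems obtain bs where a: "a = u" and ys: "ys = u # bs"
    by (cases ys) (auto simp: paths_between_def)
  show ?case
  proof (cases "xs = [] \<or> bs = []")
    case True
    then show ?thesis using Cons.prems unfolding a ys
      by (auto simp: paths_between_def split: if_splits)
  next
    case False
    have xs': "xs \<in> paths_between V E (hd xs) w" and bs': "bs \<in> paths_between V E (hd bs) w"
      using Cons.prems False unfolding a ys by (auto simp: paths_between_def walk_edges_Cons)
    show ?thesis
    proof (cases "hd xs = hd bs")
      case True
      then show ?thesis using Cons.IH[OF xs'] bs' a ys by simp
    next
      case neq: False
      \<comment> \<open>Both tails end in \<open>w\<close>, so a first meeting vertex
        \<open>z\<close> exists.\<close>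
      have "\<exists>x\<in>set xs. x \<in> set bs"
        using xs' bs' last_in_set[of xs] last_in_set[of bs]
        by (auto simp: paths_between_def intro!: bexI[of _ w])
      then obtain p z q where xs: "xs = p @ z # q" and z: "z \<in> set bs"
        and p: "\<forall>x\<in>set p. x \<notin> set bs"
        using split_list_first_prop[of xs "\<lambda>x. x \<in> set bs"] by blast
      obtain p' q' where bs: "bs = p' @ z # q'"
        using split_list[OF z] by blast
      have 1: "u # p @ [z] \<in> paths_between V E u z" "u # p' @ [z] \<in> paths_between V E u z"
        using Cons.prems paths_between_split(1)[of "u # p" z q V E u w]
          paths_between_split(1)[of "u # p'" z q' V E u w] by (auto simp: a ys xs bs)
      define c where "c = (u # p) @ z # rev p'"
      have c_edges: "walk_edges c = walk_edges (u # p @ [z]) @ walk_edges (z # rev p')"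
        unfolding c_def by (subst walk_edges_append) simp
      have 2: "walk_edges (z # rev p') = rev (walk_edges (p' @ [z]))"
        using walk_edges_rev[of "p' @ [z]"] by simp
      have 3: "walk_edges (u # p' @ [z]) = {u, hd (p' @ [z])} # walk_edges (p' @ [z])"
        by (rule walk_edges_Cons) simp
      have "last c = hd (p' @ [z])"
        by (cases p') (auto simp: c_def)
      \<comment> \<open>If both segments were empty, the second vertices would both be
        \<open>z\<close>. So \<open>c\<close> has a third vertex besides \<open>u\<close> and
        \<open>z\<close>.\<close>
      moreover have "p \<noteq> [] \<or> p' \<noteq> []" using neq xs bs by auto
      then have "length c \<ge> 3" by (cases p; cases p') (auto simp: c_def)
      moreover have "distinct c" using p 1 bs by (auto simp: c_def paths_between_def)
      moreover have "set (walk_edges c) \<subseteq> E" "set c \<subseteq> V" "{u, hd (p' @ [z])} \<in> E"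
        using 1 unfolding c_edges 2 by (auto simp: c_def paths_between_def 3)
      ultimately have "is_cycle V E c"
        by (auto simp: is_cycle_def c_def insert_commute)
      then show ?thesis using assms by blast
    qed
  qed
qed

section \<open>Paths and distances in a tree with unit lengths\<close>

locale tree_graph =
  fixes V :: "'a set" and E :: "'a set set" and l :: "'a set \<Rightarrow> real"
  assumes is_tree: "is_tree V E" and unit_lengths: "f \<in> E \<Longrightarrow> l f = 1"
begin

lemma finite_V: "finite V" and edge_subset: "f \<in> E \<Longrightarrow> f \<subseteq> V" and edge_card: "f \<in> E \<Longrightarrow> card f = 2"
  using is_tree by (auto simp: is_tree_def simple_graph_def)

lemma edgeD: "{x, y} \<in> E \<Longrightarrow> x \<in> V \<and> y \<in> V \<and> x \<noteq> y"
  using edge_subset edge_card by fastforce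

definition tree_path :: "'a \<Rightarrow> 'a \<Rightarrow> 'a list" where
  "tree_path u w = (THE xs. xs \<in> paths_between V E u w)"

text \<open>Natural-number valued, unlike \<open>graph_dist\<close>, so that strict inequalities
  gain a whole unit in linear arithmetic.\<close>

definition tree_dist :: "'a \<Rightarrow> 'a \<Rightarrow> nat" where
  "tree_dist u w = length (tree_path u w) - 1"

lemma tree_path_eq: "xs \<in> paths_between V E u w \<Longrightarrow> tree_path u w = xs"
  unfolding tree_path_def using is_tree acyclic_paths_between_unique[of V E]
  by (intro the_equality) (auto simp: is_tree_def)

lemma tree_path_in: "u \<in> V \<Longrightarrow> w \<in> V \<Longrightarrow> tree_path u w \<in> paths_between V E u w"
  using is_tree tree_path_eq unfolding is_tree_def graph_connected_def by fastforce

lemma paths_between_eq: "u \<in> V \<Longrightarrow> w \<in> V \<Longrightarrow> paths_between V E u w = {tree_path u w}"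
  using tree_path_in tree_path_eq by fastforce

lemma tree_path_not_Nil: "u \<in> V \<Longrightarrow> w \<in> V \<Longrightarrow> tree_path u w \<noteq> []"
  using tree_path_in[of u w] by (auto simp: paths_between_def)

lemma length_tree_path: "u \<in> V \<Longrightarrow> w \<in> V \<Longrightarrow> length (tree_path u w) = Suc (tree_dist u w)"
  using tree_path_not_Nil[of u w] by (cases "tree_path u w") (auto simp: tree_dist_def)

lemma in_tree_path: "u \<in> V \<Longrightarrow> w \<in> V \<Longrightarrow> w \<in> set (tree_path u w)"
  using tree_path_in[of u w] last_in_set[of "tree_path u w"] by (simp add: paths_between_def)

lemma tree_path_self: "u \<in> V \<Longrightarrow> tree_path u u = [u]"
  by (rule tree_path_eq) (simp add: paths_between_def)

lemma tree_dist_self: "u \<in> V \<Longrightarrow> tree_dist u u = 0"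
  by (simp add: tree_dist_def tree_path_self)

lemma tree_dist_commute: "u \<in> V \<Longrightarrow> w \<in> V \<Longrightarrow> tree_dist u w = tree_dist w u"
  using tree_path_eq[OF paths_between_rev[OF tree_path_in[of u w]]] by (simp add: tree_dist_def)

lemma tree_dist_eq_0_iff: "u \<in> V \<Longrightarrow> w \<in> V \<Longrightarrow> tree_dist u w = 0 \<longleftrightarrow> u = w"
  using tree_path_in[of u w] length_tree_path[of u w] tree_dist_self
  by (auto simp: paths_between_def length_Suc_conv)

lemma tree_path_split:
  assumes "u \<in> V" "w \<in> V" "tree_path u w = p @ x # q"
  shows "x \<in> V" "tree_path u x = p @ [x]" "tree_path x w = x # q"
    "tree_dist u w = tree_dist u x + tree_dist x w"
proof -
  have in_paths: "p @ x # q \<in> paths_between V E u w" using tree_path_in[OF assms(1,2)] assms(3) by simp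
  then show "x \<in> V" by (auto simp: paths_between_def)
  from in_paths show *: "tree_path u x = p @ [x]" "tree_path x w = x # q"
    using paths_between_split tree_path_eq by metis+
  show "tree_dist u w = tree_dist u x + tree_dist x w"
    by (simp add: tree_dist_def * assms(3))
qed

text \<open>If \<open>y\<close> is off the path to \<open>x\<close>, appending \<open>y\<close>
  gives the path to \<open>y\<close>. Otherwise the path to \<open>x\<close> passes through
  \<open>y\<close>; its prefix up to \<open>y\<close> misses \<open>x\<close>, so appending
  \<open>x\<close> gives a path that uniqueness identifies with the path to
  \<open>x\<close>.\<close>

lemma tree_path_edge:
  assumes "u \<in> V" "{x, y} \<in> E"
  shows "tree_path u y = tree_path u x @ [y] \<or> tree_path u x = tree_path u y @ [x]"
proof (cases "y \<in> set (tree_path u x)")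
  case False
  then show ?thesis
    using paths_between_snoc[OF tree_path_in] edgeD assms tree_path_eq by metis
next
  case True
  have xy: "x \<in> V" "y \<in> V" "x \<noteq> y" using edgeD assms by auto
  obtain p q where pq: "tree_path u x = p @ y # q" using split_list[OF True] by blast
  have uy: "tree_path u y = p @ [y]" using tree_path_split(2)[OF assms(1) xy(1) pq] .
  have "last (tree_path u x) = x" "distinct (tree_path u x)"
    using tree_path_in[OF assms(1) xy(1)] by (auto simp: paths_between_def)
  then have "x \<notin> set (p @ [y])" using pq xy(3) by (auto split: if_splits)
  then show ?thesis
    using paths_between_snoc[OF tree_path_in[OF assms(1) xy(2)], of x] assms xy uy tree_path_eq
    by (metis insert_commute)
qed

lemma tree_dist_edge:
  assumes "u \<in> V" "{x, y} \<in> E"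
  shows "tree_dist u y = Suc (tree_dist u x) \<or> tree_dist u x = Suc (tree_dist u y)"
  using tree_path_edge[OF assms] edgeD[OF assms(2)] length_tree_path[OF assms(1)]
  by (metis length_append_singleton nat.inject)

lemma tree_path_step:
  assumes "u \<in> V" "{x, y} \<in> E" "tree_dist u x < tree_dist u y"
  shows "tree_path u y = tree_path u x @ [y]"
  using tree_path_edge[OF assms(1,2)] assms(3) by (auto simp: tree_dist_def)

text \<open>With the tree rooted at \<open>u\<close>, a parent is unique: removing the last vertex
  of \<open>tree_path u y\<close> yields the path to either candidate.\<close>

lemma pred_unique:
  assumes "u \<in> V" "{x, y} \<in> E" "tree_dist u x < tree_dist u y"
    "{z, y} \<in> E" "tree_dist u z < tree_dist u y"
  shows "x = z"
proof -
  have "tree_path u x = tree_path u z"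
    using tree_path_step assms by (metis append1_eq_conv)
  then show ?thesis
    using tree_path_in[of u x] tree_path_in[of u z] edgeD assms by (auto simp: paths_between_def)
qed

lemma pred_exists:
  assumes "u \<in> V" "y \<in> V" "u \<noteq> y"
  obtains x where "{x, y} \<in> E" "tree_dist u y = Suc (tree_dist u x)"
proof -
  have path: "tree_path u y \<in> paths_between V E u y" using tree_path_in assms by auto
  then obtain p where p: "tree_path u y = p @ [y]"
    by (cases "tree_path u y" rule: rev_cases) (auto simp: paths_between_def)
  then have "p \<noteq> []" using path assms by (auto simp: paths_between_def)
  then obtain p' x where p': "p = p' @ [x]" by (cases p rule: rev_cases) auto
  have "tree_path u y = p' @ x # [y]" using p p' by simp
  note s = tree_path_split[OF assms(1,2) this]
  have "{x, y} \<in> E" using tree_path_in[OF s(1) assms(2)] s(3) by (auto simp: paths_between_def)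
  moreover have "tree_dist u y = Suc (tree_dist u x)" using s by (simp add: tree_dist_def)
  ultimately show ?thesis by (rule that)
qed

text \<open>Walking from \<open>x\<close> to \<open>w\<close> edge by edge raises the distance from
  \<open>u\<close> by at most one per step.\<close>

lemma tree_dist_triangle:
  assumes "u \<in> V" "x \<in> V" "w \<in> V"
  shows "tree_dist u w \<le> tree_dist u x + tree_dist x w"
  using assms(3)
proof (induction "tree_dist x w" arbitrary: w)
  case 0
  then show ?case using assms tree_dist_eq_0_iff by auto
next
  case (Suc k)
  then obtain y where y: "{y, w} \<in> E" "tree_dist x w = Suc (tree_dist x y)"
    using pred_exists[OF assms(2) Suc.prems] tree_dist_self by (metis nat.distinct(1))
  then have "tree_dist u y \<le> tree_dist u x + tree_dist x y"
    using Suc.hyps edgeD by simp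
  then show ?case using tree_dist_edge[OF assms(1) y(1)] y(2) by auto
qed

lemma tree_path_rev: "u \<in> V \<Longrightarrow> w \<in> V \<Longrightarrow> tree_path w u = rev (tree_path u w)"
  by (rule tree_path_eq[OF paths_between_rev[OF tree_path_in]])

lemma sum_list_path:
  assumes "u \<in> V" "w \<in> V"
  shows "sum_list (map l (walk_edges (tree_path u w))) = real (tree_dist u w)"
proof -
  have "set (walk_edges (tree_path u w)) \<subseteq> E"
    using tree_path_in[OF assms] by (simp add: paths_between_def)
  then have "map l (walk_edges (tree_path u w)) = map (\<lambda>_. 1) (walk_edges (tree_path u w))"
    using unit_lengths by auto
  then show ?thesis by (simp only: sum_list_triv length_walk_edges tree_dist_def mult_1_right)
qed

text \<open>A path in \<open>F\<close> is also a path in \<open>E\<close>, hence is the tree path.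
  Deleting edges therefore leaves each distance unchanged or makes it infinite.\<close>

lemma graph_dist_subgraph:
  assumes "F \<subseteq> E" "u \<in> V" "w \<in> V"
  shows "graph_dist V F l u w =
    (if set (walk_edges (tree_path u w)) \<subseteq> F then ereal (tree_dist u w) else \<infinity>)"
proof -
  have "paths_between V F u w = {xs \<in> paths_between V E u w. set (walk_edges xs) \<subseteq> F}"
    using assms(1) by (auto simp: paths_between_def)
  also have "\<dots> = (if set (walk_edges (tree_path u w)) \<subseteq> F then {tree_path u w} else {})"
    unfolding paths_between_eq[OF assms(2,3)] by auto
  finally show ?thesis by (simp add: graph_dist_def sum_list_path assms(2,3) top_ereal_def)
qed

lemma graph_dist_tree:
  assumes "u \<in> V" "w \<in> V"
  shows "graph_dist V E l u w = ereal (tree_dist u w)"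
  using tree_path_in[OF assms] by (simp add: graph_dist_subgraph assms paths_between_def)

section \<open>Convexity of the distance sum and the location of the medians\<close>

definition cost :: "'a \<Rightarrow> nat" where
  "cost x = (\<Sum>u\<in>V. tree_dist u x)"

lemma sum_graph_dist: "x \<in> V \<Longrightarrow> (\<Sum>u\<in>V. graph_dist V E l u x) = ereal (cost x)"
  by (simp add: graph_dist_tree cost_def)

lemma one_medians_eq: "one_medians V E l = {x \<in> V. \<forall>y\<in>V. cost x \<le> cost y}"
  unfolding one_medians_def by (auto simp: sum_graph_dist)

lemma one_medians_nonempty: "one_medians V E l \<noteq> {}"
proof -
  have "V \<noteq> {}" using is_tree by (auto simp: is_tree_def graph_connected_def)
  then have "arg_min_on cost V \<in> one_medians V E l"
    using arg_min_if_finite[OF finite_V, of cost] by (auto simp: one_medians_eq not_less)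
  then show ?thesis by blast
qed

text \<open>For every \<open>u\<close>, at most one of the two neighbours of \<open>b\<close> is
  closer to \<open>u\<close> than \<open>b\<close>, and the other is one farther, so each summand is
  convex. The term \<open>u = b\<close> is 0 at \<open>b\<close> and 1 at both neighbours, which
  yields the extra 2.\<close>

lemma cost_strictly_convex:
  assumes "{a, b} \<in> E" "{b, c} \<in> E" "a \<noteq> c"
  shows "2 * cost b + 2 \<le> cost a + cost c"
proof -
  have b: "b \<in> V" using edgeD assms by blast
  have "2 * tree_dist u b + (if u = b then 2 else 0) \<le> tree_dist u a + tree_dist u c"
    if u: "u \<in> V" for u
  proof -
    have "\<not> (tree_dist u a < tree_dist u b \<and> tree_dist u c < tree_dist u b)"
      using pred_unique[OF u assms(1), of c] assms by (auto simp: insert_commute)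
    moreover have "u = b \<Longrightarrow> tree_dist u b = 0" using tree_dist_self u by simp
    ultimately show ?thesis
      using tree_dist_edge[OF u assms(1)] tree_dist_edge[OF u assms(2)] by auto
  qed
  then have "(\<Sum>u\<in>V. 2 * tree_dist u b + (if u = b then 2 else 0)) \<le>
      (\<Sum>u\<in>V. tree_dist u a + tree_dist u c)"
    by (rule sum_mono)
  then show ?thesis
    using b finite_V by (simp add: sum.distrib cost_def sum_distrib_left[symmetric])
qed

text \<open>Moving away from \<open>r\<close>, the first edge has nonnegative slope because
  \<open>r\<close> is a minimizer. Strict convexity raises the slope by at least 2 at each further
  edge.\<close>

lemma median_slope:
  assumes "r \<in> one_medians V E l" "{x, y} \<in> E" "tree_dist r y = Suc (tree_dist r x)"
  shows "cost x \<le> cost y \<and> (x \<noteq> r \<longrightarrow> cost x + 2 \<le> cost y)"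
  using assms(2,3)
proof (induction "tree_dist r x" arbitrary: x y rule: less_induct)
  case less
  have r: "r \<in> V" and xy: "x \<in> V" "y \<in> V" using assms(1) edgeD less.prems by (auto simp: one_medians_eq)
  show ?case
  proof (cases "x = r")
    case True
    then show ?thesis using assms(1) xy by (simp add: one_medians_eq)
  next
    case False
    then obtain z where z: "{z, x} \<in> E" "tree_dist r x = Suc (tree_dist r z)"
      using pred_exists[OF r xy(1)] by metis
    have "cost z \<le> cost x" using less.hyps[OF _ z] z by simp
    moreover have "z \<noteq> y" using z less.prems by auto
    ultimately show ?thesis using cost_strictly_convex[OF z(1) less.prems(1)] by linarith
  qed
qed

text \<open>Sums the slopes along the path: at least 0 on the first edge and at least 2 on each
  later one. The 2 on the right accounts for the first edge without subtraction.\<close>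

lemma median_growth:
  assumes "r \<in> one_medians V E l" "x \<in> V" "x \<noteq> r"
  shows "cost r + 2 * tree_dist r x \<le> cost x + 2"
  using assms(2,3)
proof (induction "tree_dist r x" arbitrary: x rule: less_induct)
  case less
  have r: "r \<in> V" using assms(1) by (simp add: one_medians_eq)
  obtain y where y: "{y, x} \<in> E" "tree_dist r x = Suc (tree_dist r y)"
    using pred_exists[OF r less.prems(1)] less.prems(2) by metis
  show ?case
  proof (cases "y = r")
    case True
    then show ?thesis using median_slope[OF assms(1) y] y tree_dist_self[OF r] by simp
  next
    case False
    then have "cost r + 2 * tree_dist r y \<le> cost y + 2"
      using less.hyps[of y] y edgeD by simp
    then show ?thesis using median_slope[OF assms(1) y] y False by simp
  qed
qed

text \<open>Equal costs reduce the growth bound to twice the distance being at most 2.\<close>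

lemma medians_adjacent:
  assumes "r \<in> one_medians V E l" "s \<in> one_medians V E l" "r \<noteq> s"
  shows "{r, s} \<in> E"
proof -
  have rs: "r \<in> V" "s \<in> V" "cost r = cost s"
    using assms by (auto simp: one_medians_eq intro: antisym)
  obtain x where x: "{x, s} \<in> E" "tree_dist r s = Suc (tree_dist r x)"
    using pred_exists[OF rs(1,2) assms(3)] by metis
  have "tree_dist r x = 0" using median_growth[OF assms(1) rs(2)] assms(3) rs(3) x(2) by auto
  then show ?thesis using tree_dist_eq_0_iff[OF rs(1), of x] x(1) edgeD by auto
qed

text \<open>The median depends on \<open>x\<close>: a median is paired with itself, since a second
  median has equal cost at distance 1.\<close>

lemma cost_ge_median_dist:
  assumes "x \<in> V"
  obtains r where "r \<in> one_medians V E l" "cost r + tree_dist r x \<le> cost x"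
proof (cases "x \<in> one_medians V E l")
  case True
  show ?thesis by (rule that[OF True]) (simp add: tree_dist_self assms)
next
  case False
  obtain r where r: "r \<in> one_medians V E l" using one_medians_nonempty by blast
  obtain y where "y \<in> V" "cost y < cost x"
    using False assms by (auto simp: one_medians_eq not_le)
  moreover have "cost r \<le> cost y" using r \<open>y \<in> V\<close> by (simp add: one_medians_eq)
  moreover have "x \<noteq> r" using r False by blast
  \<comment> \<open>Averaging the growth bound with \<open>cost r + 1 \<le> cost x\<close> gives the
    claim up to one half, which integrality removes.\<close>
  ultimately have "cost r + tree_dist r x \<le> cost x"
    using median_growth[OF r assms] by linarith
  then show ?thesis using that r by blast
qed

section \<open>Branches of the rooted tree and the effect of deleting one edge\<close>

definition branch :: "'a \<Rightarrow> 'a \<Rightarrow> 'a set" where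
  "branch r b = {x \<in> V. b \<in> set (tree_path r x)}"

lemma branch_tree_dist:
  assumes "r \<in> V" "x \<in> branch r b"
  shows "tree_dist r x = tree_dist r b + tree_dist b x"
  using assms split_list[of b "tree_path r x"] tree_path_split(4)[OF assms(1)]
  by (auto simp: branch_def)

text \<open>The path from \<open>r\<close> to \<open>x\<close> visits \<open>a\<close> just before
  \<open>b\<close> and never returns to it. Hence \<open>b\<close> still reaches its whole branch
  when \<open>{a, b}\<close> is deleted.\<close>

lemma branch_path_avoids:
  assumes "{a, b} \<in> E" "r \<in> V" "tree_dist r a < tree_dist r b" "x \<in> branch r b"
  shows "a \<notin> set (tree_path b x)"
proof -
  have x: "x \<in> V" and ab: "a \<in> V" using assms edgeD by (auto simp: branch_def)
  obtain p q where pq: "tree_path r x = p @ b # q"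
    using assms(4) split_list by (force simp: branch_def)
  have "tree_path r b = p @ [b]" "tree_path b x = b # q"
    using tree_path_split[OF assms(2) x pq] by auto
  moreover have "tree_path r b = tree_path r a @ [b]" using tree_path_step assms by blast
  moreover have "a \<in> set (tree_path r a)"
    using in_tree_path[OF assms(2) ab] .
  moreover have "distinct (tree_path r x)"
    using tree_path_in[OF assms(2) x] by (auto simp: paths_between_def)
  ultimately show ?thesis using pq by auto
qed

text \<open>Take \<open>r\<close> and \<open>b\<close> as locations. Vertices outside the branch
  keep their path to \<open>r\<close>; those inside switch to \<open>b\<close> and each save
  \<open>tree_dist r b\<close>.\<close>

lemma median_value_cut_le:
  assumes "{a, b} \<in> E" "r \<in> V" "tree_dist r a < tree_dist r b"
  shows "median_value V (E - {{a, b}}) l 2 \<le>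
    ereal (real (cost r) - real (card (branch r b) * tree_dist r b))"
proof -
  let ?F = "E - {{a, b}}"
  have b: "b \<in> V" using edgeD assms by blast
  have "r \<noteq> b" using assms(3) tree_dist_self[OF b] by auto
  have edges: "set (walk_edges (tree_path u w)) \<subseteq> E" if "u \<in> V" "w \<in> V" for u w
    using tree_path_in[OF that] by (simp add: paths_between_def)
  have le: "dist_to_set V ?F l x {r, b} \<le>
      ereal (real (tree_dist x r) - (if x \<in> branch r b then real (tree_dist r b) else 0))"
    if x: "x \<in> V" for x
  proof (cases "x \<in> branch r b")
    case True
    have "{a, b} \<notin> set (walk_edges (tree_path b x))"
      using branch_path_avoids[OF assms True] walk_edges_subset by fastforce
    then have "graph_dist V ?F l x b = ereal (tree_dist x b)"
      using edges[OF x b] by (auto simp: graph_dist_subgraph x b tree_path_rev[OF b x] walk_edges_rev)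
    then show ?thesis
      using branch_tree_dist[OF assms(2) True] True
      by (auto simp: dist_to_set_def tree_dist_commute[of x] x b assms(2) intro: INF_lower2[of b])
  next
    case False
    \<comment> \<open>Outside the branch the path from \<open>r\<close> does not even visit
      \<open>b\<close>.\<close>
    then have "{a, b} \<notin> set (walk_edges (tree_path r x))"
      using x walk_edges_subset by (fastforce simp: branch_def)
    then have "graph_dist V ?F l x r = ereal (tree_dist x r)"
      using edges[OF x assms(2)]
      by (auto simp: graph_dist_subgraph x assms(2) tree_path_rev[OF assms(2) x] walk_edges_rev)
    then show ?thesis using False by (auto simp: dist_to_set_def intro: INF_lower2[of r])
  qed
  have "median_value V ?F l 2 \<le> (\<Sum>x\<in>V. dist_to_set V ?F l x {r, b})"
    unfolding median_value_def using b assms(2) \<open>r \<noteq> b\<close> by (intro INF_lower) auto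
  also have "\<dots> \<le> (\<Sum>x\<in>V. ereal (real (tree_dist x r) - (if x \<in> branch r b then real (tree_dist r b) else 0)))"
    by (intro sum_mono le)
  also have "\<dots> = ereal (real (cost r) - (\<Sum>x\<in>V. if x \<in> branch r b then real (tree_dist r b) else 0))"
    by (simp add: cost_def sum_subtractf)
  also have "(\<Sum>x\<in>V. if x \<in> branch r b then real (tree_dist r b) else 0) =
      (\<Sum>x\<in>V \<inter> branch r b. real (tree_dist r b))"
    by (rule sum.inter_restrict[OF finite_V, symmetric])
  also have "V \<inter> branch r b = branch r b" by (auto simp: branch_def)
  finally show ?thesis by simp
qed

text \<open>A vertex \<open>w\<close> of the branch farthest from \<open>r\<close> is a leaf: a
  neighbour farther from \<open>r\<close> would again lie in the branch, and the closer neighbour is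
  unique.\<close>

lemma branch_leaf:
  assumes "r \<in> V" "b \<in> V" "r \<noteq> b"
  obtains w where "w \<in> branch r b" "is_leaf V E w" "tree_dist r w \<le> card (branch r b) * tree_dist r b"
proof -
  let ?B = "branch r b"
  have fin: "finite ?B" using finite_V by (auto simp: branch_def)
  have "b \<in> ?B" using in_tree_path[OF assms(1,2)] assms(2) by (simp add: branch_def)
  then have "Max (tree_dist r ` ?B) \<in> tree_dist r ` ?B" using fin by (intro Max_in) auto
  then obtain w where w: "w \<in> ?B" "tree_dist r w = Max (tree_dist r ` ?B)" by auto
  have w_max: "tree_dist r x \<le> tree_dist r w" if "x \<in> ?B" for x
    using that fin w(2) by simp
  have wV: "w \<in> V" using w by (simp add: branch_def)
  have db: "tree_dist r b > 0" using tree_dist_eq_0_iff assms by auto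
  then have "r \<noteq> w" using branch_tree_dist[OF assms(1) w(1)] tree_dist_self[OF assms(1)] by auto
  then obtain x where x: "{x, w} \<in> E" "tree_dist r w = Suc (tree_dist r x)"
    using pred_exists[OF assms(1) wV] by metis
  have "f = {x, w}" if f: "f \<in> E" "w \<in> f" for f
  proof -
    obtain y where y: "f = {y, w}" using f edge_card[OF f(1)] by (auto simp: card_2_iff)
    have "\<not> tree_dist r w < tree_dist r y"
    proof
      assume less: "tree_dist r w < tree_dist r y"
      have "tree_path r y = tree_path r w @ [y]"
        using tree_path_step[OF assms(1) _ less] f y by (simp add: insert_commute)
      then have "y \<in> ?B" using w(1) edgeD[of y w] f y by (auto simp: branch_def)
      then show False using w_max less by force
    qed
    then have "tree_dist r y < tree_dist r w" using tree_dist_edge[OF assms(1), of y w] f y by auto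
    then have "y = x" using pred_unique[OF assms(1)] f y x by (metis lessI)
    then show ?thesis using y by simp
  qed
  then have "{f \<in> E. w \<in> f} \<subseteq> {{x, w}}" by blast
  then have "{f \<in> E. w \<in> f} = {{x, w}}" using x(1) by (intro equalityI) simp_all
  then have "is_leaf V E w" using wV by (simp add: is_leaf_def)
  moreover have "tree_dist r w \<le> card ?B * tree_dist r b"
  proof -
    obtain p q where pq: "tree_path r w = p @ b # q"
      using w(1) split_list by (force simp: branch_def)
    \<comment> \<open>The path from \<open>r\<close> to any vertex at or after \<open>b\<close> is a
      prefix that contains \<open>b\<close>, so the branch has at least as many vertices as the path
      from \<open>b\<close> to \<open>w\<close>.\<close>
    have "set (b # q) \<subseteq> ?B"
    proof
      fix y assume "y \<in> set (b # q)"
      then obtain q1 q2 where "b # q = q1 @ y # q2" using split_list by metis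
      then have "tree_path r w = (p @ q1) @ y # q2" "b \<in> set (q1 @ [y])"
        using pq by (auto, cases q1) auto
      then show "y \<in> ?B"
        using tree_path_split(1,2)[OF assms(1) wV, of "p @ q1" y q2] by (auto simp: branch_def)
    qed
    moreover have "distinct (b # q)"
      using tree_path_in[OF assms(1) wV] pq by (auto simp: paths_between_def)
    ultimately have "length (b # q) \<le> card ?B"
      using card_mono[OF fin] distinct_card by metis
    then have "Suc (tree_dist b w) \<le> card ?B"
      using tree_path_split(3)[OF assms(1) wV pq] length_tree_path[OF assms(2) wV] by simp
    then have "Suc (tree_dist b w) * tree_dist r b \<le> card ?B * tree_dist r b"
      by (rule mult_le_mono1)
    \<comment> \<open>Uses \<open>tree_dist r b \<ge> 1\<close>. Together with the product bound it
      leaves \<open>tree_dist r b + tree_dist b w\<close> on the left.\<close>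
    moreover have "tree_dist b w \<le> tree_dist b w * tree_dist r b"
      using db by simp
    ultimately show ?thesis using branch_tree_dist[OF assms(1) w(1)]
      unfolding mult_Suc by linarith
  qed
  ultimately show ?thesis using that w(1) by blast
qed

text \<open>Deleting \<open>e\<close> isolates \<open>v\<close>. Without \<open>v\<close> among the
  locations the value is infinite. With \<open>{v, x}\<close>, all other vertices must use
  \<open>x\<close>, which costs at least \<open>cost x\<close> minus the term of
  \<open>v\<close>.\<close>

lemma median_value_leaf_cut_ge:
  assumes "is_leaf V E v" "e \<in> E" "v \<in> e"
    and k: "\<And>x. x \<in> V \<Longrightarrow> x \<noteq> v \<Longrightarrow> k \<le> real (cost x) - real (tree_dist v x)"
  shows "ereal k \<le> median_value V (E - {e}) l 2"
  unfolding median_value_def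
proof (rule INF_greatest)
  fix X assume "X \<in> {X. X \<subseteq> V \<and> card X = 2}"
  then have X: "X \<subseteq> V" "card X = 2" by auto
  let ?F = "E - {e}"
  have v: "v \<in> V" using assms(1) by (simp add: is_leaf_def)
  obtain f where "{f \<in> E. v \<in> f} = {f}"
    using assms(1) unfolding is_leaf_def by (metis card_1_singletonE)
  moreover have "e \<in> {f \<in> E. v \<in> f}" using assms(2,3) by simp
  ultimately have only: "f = e" if "f \<in> E" "v \<in> f" for f
    using that by (metis (mono_tags, lifting) mem_Collect_eq singletonD)
  have inf1: "graph_dist V ?F l v x = \<infinity>" if x: "x \<in> V" "x \<noteq> v" for x
  proof -
    have P: "tree_path v x \<in> paths_between V E v x" using tree_path_in v x by blast
    then obtain y q where y: "tree_path v x = v # y # q"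
      using x(2) by (cases "tree_path v x" rule: walk_edges.cases) (auto simp: paths_between_def)
    then have "{v, y} = e" using P only by (auto simp: paths_between_def)
    then show ?thesis using y by (auto simp: graph_dist_subgraph v x)
  qed
  have inf2: "graph_dist V ?F l x v = \<infinity>" if x: "x \<in> V" "x \<noteq> v" for x
    using inf1[OF x] x v
    by (auto simp: graph_dist_subgraph tree_path_rev[of v x] walk_edges_rev split: if_splits)
  have ge: "ereal (tree_dist u x) \<le> graph_dist V ?F l u x" if "u \<in> V" "x \<in> V" for u x
    using that by (simp add: graph_dist_subgraph)
  have nonneg: "0 \<le> dist_to_set V ?F l u X" if "u \<in> V" for u
    unfolding dist_to_set_def
  proof (rule INF_greatest)
    fix x assume "x \<in> X"
    then show "0 \<le> graph_dist V ?F l u x"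
      using ge[OF that, of x] X by (meson ereal_less_eq(5) of_nat_0_le_iff order_trans subsetD)
  qed
  show "ereal k \<le> (\<Sum>u\<in>V. dist_to_set V ?F l u X)"
  proof (cases "v \<in> X")
    case False
    have "dist_to_set V ?F l v X = (INF x\<in>X. \<infinity>)"
      unfolding dist_to_set_def using False X inf1 by (intro INF_cong) auto
    then have "dist_to_set V ?F l v X = \<infinity>"
      using X by (auto simp: top_ereal_def card_2_iff)
    then have "(\<Sum>u\<in>V. dist_to_set V ?F l u X) = \<infinity>"
      using v finite_V by (auto simp: sum_Pinfty)
    then show ?thesis by simp
  next
    case True
    then obtain x where x: "X = {v, x}" "x \<noteq> v" using X(2) by (auto simp: card_2_iff)
    then have xV: "x \<in> V" using X by auto
    have "real (cost x) = real (tree_dist v x) + (\<Sum>u\<in>V - {v}. real (tree_dist u x))"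
      unfolding cost_def using finite_V v by (simp add: sum.remove)
    then have "ereal k \<le> ereal (\<Sum>u\<in>V - {v}. real (tree_dist u x))"
      using k[OF xV x(2)] by simp
    also have "\<dots> = (\<Sum>u\<in>V - {v}. ereal (tree_dist u x))" by simp
    also have "\<dots> \<le> (\<Sum>u\<in>V - {v}. dist_to_set V ?F l u X)"
      using inf2 ge xV by (intro sum_mono) (simp add: dist_to_set_def x(1))
    \<comment> \<open>Adding back the nonnegative term of \<open>v\<close> only increases the
      sum.\<close>
    also have "\<dots> \<le> (\<Sum>u\<in>V. dist_to_set V ?F l u X)"
      using finite_V nonneg by (intro sum_mono2) auto
    finally show ?thesis .
  qed
qed

text \<open>Both values are compared with \<open>cost s - (m + c)\<close>: it bounds the leaf cut
  from below and the cut of \<open>f\<close> from above.\<close>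

lemma leaf_cut_ge_edge_cut:
  assumes leaf: "is_leaf V E v" "e \<in> E" "v \<in> e"
    and closest: "\<And>w. is_leaf V E w \<Longrightarrow>
      (INF r\<in>one_medians V E l. graph_dist V E l r v) \<le> (INF r\<in>one_medians V E l. graph_dist V E l r w)"
    and f: "f \<in> E"
  shows "median_value V (E - {f}) l 2 \<le> median_value V (E - {e}) l 2"
proof -
  let ?R = "one_medians V E l"
  have RV: "r \<in> V" if "r \<in> ?R" for r using that by (simp add: one_medians_eq)
  have same_cost: "cost r = cost s" if "r \<in> ?R" "s \<in> ?R" for r s
    using that by (auto simp: one_medians_eq intro: antisym)
  have v: "v \<in> V" using leaf by (simp add: is_leaf_def)
  obtain s where s: "s \<in> ?R" "\<And>r. r \<in> ?R \<Longrightarrow> tree_dist s v \<le> tree_dist r v"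
    using one_medians_nonempty ex_has_least_nat[of "\<lambda>r. r \<in> ?R" _ "\<lambda>r. tree_dist r v"] by blast
  define m where "m = tree_dist s v"
  have m_le: "m \<le> tree_dist r w" if w: "is_leaf V E w" and r: "r \<in> ?R" for r w
  proof -
    have "ereal m \<le> (INF r\<in>?R. graph_dist V E l r v)"
      by (rule INF_greatest) (simp add: graph_dist_tree RV v m_def s(2))
    also have "\<dots> \<le> (INF r\<in>?R. graph_dist V E l r w)" by (rule closest[OF w])
    also have "\<dots> \<le> graph_dist V E l r w" by (rule INF_lower[OF r])
    also have "\<dots> = ereal (tree_dist r w)"
      using w by (intro graph_dist_tree RV[OF r]) (simp add: is_leaf_def)
    finally show ?thesis by simp
  qed
  \<comment> \<open>A second median is adjacent to \<open>s\<close>, so it can be at most one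
    farther from \<open>v\<close>.\<close>
  define c :: nat where "c = (if \<exists>r\<in>?R. r \<noteq> s then 1 else 0)"
  have dist_v: "tree_dist v r \<le> m + c" if r: "r \<in> ?R" for r
  proof (cases "r = s")
    case True
    then show ?thesis using tree_dist_commute[OF v RV[OF r]] by (simp add: m_def)
  next
    case False
    then have "c = 1" using r by (auto simp: c_def)
    then show ?thesis
      using tree_dist_edge[OF v medians_adjacent[OF r s(1) False]] tree_dist_commute[OF v RV[OF s(1)]]
      by (auto simp: m_def)
  qed
  have lower: "ereal (real (cost s) - real (m + c)) \<le> median_value V (E - {e}) l 2"
  proof (rule median_value_leaf_cut_ge[OF leaf])
    fix x assume x: "x \<in> V" "x \<noteq> v"
    obtain r where r: "r \<in> ?R" "cost r + tree_dist r x \<le> cost x"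
      using cost_ge_median_dist[OF x(1)] .
    have "cost s + tree_dist v x \<le> cost x + (m + c)"
      using tree_dist_triangle[OF v RV[OF r(1)] x(1)] dist_v[OF r(1)] same_cost[OF r(1) s(1)] r(2)
      by linarith
    then show "real (cost s) - real (m + c) \<le> real (cost x) - real (tree_dist v x)" by linarith
  qed
  obtain a0 b0 where ab0: "f = {a0, b0}" using edge_card[OF f] by (auto simp: card_2_iff)
  \<comment> \<open>With one median only the ends of \<open>f\<close> need to be ordered. With two,
    the median must also be chosen so as to gain the additional 1.\<close>
  have "\<exists>r\<in>?R. \<exists>a b. f = {a, b} \<and> tree_dist r a < tree_dist r b \<and>
      (\<forall>w\<in>branch r b. is_leaf V E w \<longrightarrow> m + c \<le> tree_dist r w)"
  proof (cases "\<exists>t\<in>?R. t \<noteq> s")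
    case False
    then have c: "c = 0" by (simp add: c_def)
    have "tree_dist s b0 = Suc (tree_dist s a0) \<or> tree_dist s a0 = Suc (tree_dist s b0)"
      using tree_dist_edge[OF RV[OF s(1)]] f ab0 by blast
    then obtain a b where "f = {a, b}" "tree_dist s a < tree_dist s b"
      using ab0 by (metis insert_commute lessI)
    then show ?thesis using s(1) m_le[OF _ s(1)] c by auto
  next
    case True
    then obtain t where t: "t \<in> ?R" "t \<noteq> s" by blast
    have c: "c = 1" using True by (simp add: c_def)
    have st: "{s, t} \<in> E" using medians_adjacent s(1) t by blast
    have abV: "a0 \<in> V" "b0 \<in> V" using edgeD f ab0 by auto
    \<comment> \<open>Take the largest of the four distances between the two medians and the two ends of \<open>f\<close>.\<close>
    have "\<exists>r\<in>?R. \<exists>t\<in>?R. \<exists>a b. f = {a, b} \<and> tree_dist r a < tree_dist r b \<and> tree_dist t b < tree_dist r b"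
    proof -
      have "tree_dist s b0 = Suc (tree_dist s a0) \<or> tree_dist s a0 = Suc (tree_dist s b0)"
        "tree_dist t b0 = Suc (tree_dist t a0) \<or> tree_dist t a0 = Suc (tree_dist t b0)"
        using tree_dist_edge RV s(1) t(1) f ab0 by blast+
      moreover have "tree_dist s a0 = Suc (tree_dist t a0) \<or> tree_dist t a0 = Suc (tree_dist s a0)"
        "tree_dist s b0 = Suc (tree_dist t b0) \<or> tree_dist t b0 = Suc (tree_dist s b0)"
        using tree_dist_edge[OF abV(1) st] tree_dist_edge[OF abV(2) st]
          tree_dist_commute RV s(1) t(1) abV by metis+
      \<comment> \<open>Adjacent vertices never tie, so a largest of the four distances strictly
        exceeds both the same median's distance to the other end and the other median's distance to
        the same end.\<close>
      ultimately consider
          "tree_dist s a0 < tree_dist s b0" "tree_dist t b0 < tree_dist s b0"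
        | "tree_dist s b0 < tree_dist s a0" "tree_dist t a0 < tree_dist s a0"
        | "tree_dist t a0 < tree_dist t b0" "tree_dist s b0 < tree_dist t b0"
        | "tree_dist t b0 < tree_dist t a0" "tree_dist s a0 < tree_dist t a0"
        by linarith
      moreover have "f = {b0, a0}" using ab0 by blast
      ultimately show ?thesis using s(1) t(1) ab0 by cases blast+
    qed
    then obtain r t a b where r: "r \<in> ?R" "t \<in> ?R" "f = {a, b}" "tree_dist r a < tree_dist r b"
      "tree_dist t b < tree_dist r b" by blast
    have b: "b \<in> V" using edgeD f r(3) by blast
    \<comment> \<open>From \<open>r\<close> the way to \<open>w\<close> leads through
      \<open>b\<close>, and \<open>t\<close> is closer to \<open>b\<close>. So \<open>t\<close> is
      closer to \<open>w\<close> than \<open>r\<close> is, yet still at distance at least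
      \<open>m\<close>.\<close>
    have "m + c \<le> tree_dist r w" if w: "w \<in> branch r b" "is_leaf V E w" for w
    proof -
      have "w \<in> V" using w(1) by (simp add: branch_def)
      then have "tree_dist t w \<le> tree_dist t b + tree_dist b w"
        using tree_dist_triangle RV r(2) b by blast
      then show ?thesis
        using m_le[OF w(2) r(2)] branch_tree_dist[OF RV[OF r(1)] w(1)] r(5) c by linarith
    qed
    then show ?thesis using r by blast
  qed
  then obtain r a b where r: "r \<in> ?R" "f = {a, b}" "tree_dist r a < tree_dist r b"
    and far: "\<And>w. w \<in> branch r b \<Longrightarrow> is_leaf V E w \<Longrightarrow> m + c \<le> tree_dist r w"
    by blast
  have b: "b \<in> V" using edgeD f r(2) by blast
  have "r \<noteq> b" using r(3) tree_dist_self[OF b] by auto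
  then obtain w where w: "w \<in> branch r b" "is_leaf V E w"
    "tree_dist r w \<le> card (branch r b) * tree_dist r b"
    using branch_leaf[OF RV[OF r(1)] b] by blast
  have "median_value V (E - {f}) l 2 \<le> ereal (real (cost r) - real (card (branch r b) * tree_dist r b))"
    using median_value_cut_le[of a b r] f r RV by simp
  also have "\<dots> \<le> ereal (real (cost s) - real (m + c))"
    using order_trans[OF far[OF w(1,2)] w(3)] same_cost[OF r(1) s(1)] by (simp only: ereal_less_eq)
  also note lower
  finally show ?thesis .
qed

end

section \<open>Reduction from budgeted strategies to single-edge cuts\<close>

theorem theorem2:
  fixes V :: "'a set" and E :: "'a set set" and l b :: "'a set \<Rightarrow> real"
    and B p :: nat and Xopt :: "'a set" and v :: 'a and e :: "'a set"
  assumes tree: "is_tree V E"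
    and two_vertices: "card V \<ge> 2"
    and unit_lengths: "\<And>f. f \<in> E \<Longrightarrow> l f = 1"
    and unit_costs: "\<And>f. f \<in> E \<Longrightarrow> b f = 1"
    and budget: "B = 1"
    and locations: "p = B + 1"
    and Xopt: "Xopt = one_medians V E l"
    and leaf: "is_leaf V E v"
    and closest: "\<And>w. is_leaf V E w \<Longrightarrow>
      (INF r\<in>Xopt. graph_dist V E l r v) \<le> (INF r\<in>Xopt. graph_dist V E l r w)"
    and edge: "e \<in> E" "v \<in> e"
  shows "optimal_interdiction V E l b (real B) p (indicator {e})"
proof -
  interpret tree_graph V E l
    using tree unit_lengths by unfold_locales auto
  have fin: "finite E"
    using finite_V edge_subset by (intro finite_subset[of E "Pow V"]) auto
  have p: "p = 2" using budget locations by simp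
  have rem: "remaining_edges E (indicator {e}) = E - {e}"
    by (auto simp: remaining_edges_def indicator_def)
  have "(\<Sum>f\<in>E. b f * indicator {e} f) = (\<Sum>f\<in>E. if f = e then 1 else 0)"
    using unit_costs by (intro sum.cong) auto
  then have "indicator {e} \<in> interdiction_strategies E b (real B)"
    using fin edge budget by (auto simp: interdiction_strategies_def indicator_def)
  moreover have "interdiction_value V E l p \<gamma> \<le> interdiction_value V E l p (indicator {e})"
    if "\<gamma> \<in> interdiction_strategies E b (real B)" for \<gamma>
  proof -
    have \<gamma>: "\<gamma> f = 0 \<or> \<gamma> f = 1" if "f \<in> E" for f
      using that \<open>\<gamma> \<in> _\<close> by (auto simp: interdiction_strategies_def)
    have sum_le: "(\<Sum>f\<in>E. \<gamma> f) \<le> 1"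
      using \<open>\<gamma> \<in> _\<close> unit_costs budget by (simp add: interdiction_strategies_def)
    \<comment> \<open>The budget allows at most one deletion. If nothing is deleted, cutting
      \<open>e\<close> is at least as good, as fewer edges never lower the value.\<close>
    have "\<exists>f\<in>E. E - {f} \<subseteq> remaining_edges E \<gamma>"
    proof (cases "\<exists>f\<in>E. \<gamma> f = 1")
      case False
      then show ?thesis using edge by (auto simp: remaining_edges_def)
    next
      case True
      then obtain f where f: "f \<in> E" "\<gamma> f = 1" by blast
      have "\<gamma> g \<noteq> 1" if g: "g \<in> E - {f}" for g
      proof -
        \<comment> \<open>Since \<open>f\<close> uses up the whole budget, the sum over the other
          edges is at most 0.\<close>
        have "\<gamma> g \<le> (\<Sum>h\<in>E - {f}. \<gamma> h)"
          using g fin \<gamma> by (intro member_le_sum) fastforce+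
        then show ?thesis using sum_le f fin by (simp add: sum.remove)
      qed
      then show ?thesis using f by (auto simp: remaining_edges_def)
    qed
    then obtain f where f: "f \<in> E" "E - {f} \<subseteq> remaining_edges E \<gamma>" by blast
    have "median_value V (remaining_edges E \<gamma>) l 2 \<le> median_value V (E - {f}) l 2"
      by (rule median_value_antimono[OF f(2)])
    also have "\<dots> \<le> median_value V (E - {e}) l 2"
      using leaf_cut_ge_edge_cut[OF leaf edge _ f(1)] closest Xopt by blast
    finally show ?thesis unfolding interdiction_value_def rem p .
  qed
  ultimately show ?thesis unfolding optimal_interdiction_def by blast
qed

end
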